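(* Let $S$ be a semigroup with $|S|\ge 2$ and with no (two-sided) zero element. Then $S^0$ is uniform if and only if $S$ is uniform and has no left zero element.
   Context: A right $S$-act is a nonempty set $A$ with a map $A\times S\to A$, $(a,s)\mapsto as$, with $a(st)=(as)t$. A subact is a nonempty subset closed under the action; an $S$-homomorphism is a map $f$ with $f(as)=f(a)s$; a monomorphism is an injective $S$-homomorphism. A subact is nonzero if it is not a one-element subact. A subact $B$ of $A$ is large in $A$ if every $S$-homomorphism $g:A\to C$ (for any right $S$-act $C$) whose restriction to $B$ is injective is itself injective. A right $S$-act is uniform if every nonzero subact is large in it. A semigroup $S$ is uniform (i.e. right uniform) if the right $S$-act $S_S$ ($S$ acting on itself by right multiplication; its subacts are the nonempty right ideals) is uniform. Since $S$ has no zero element, $S^0=S\cup\{0\}$ with a new zero element $0$ adjoined. A left zero element of $S$ is $\theta$ with $\theta s=\theta$ for all $s\in S$. *)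

theory Defs
  imports Main
begin

text \<open>A semigroup \<open>S\<close> is given by its multiplication \<open>f\<close>, with \<open>semigroup f\<close> the library locale
  predicate; its underlying set is the whole type \<open>'s\<close>. Acts over \<open>S\<close> have explicit carriers.\<close>

definition right_act :: "('s \<Rightarrow> 's \<Rightarrow> 's) \<Rightarrow> 'a set \<Rightarrow> ('a \<Rightarrow> 's \<Rightarrow> 'a) \<Rightarrow> bool" where
  "right_act f A act \<longleftrightarrow>
     A \<noteq> {} \<and> (\<forall>a\<in>A. \<forall>s. act a s \<in> A) \<and> (\<forall>a\<in>A. \<forall>s t. act a (f s t) = act (act a s) t)"

definition subact :: "'a set \<Rightarrow> ('a \<Rightarrow> 's \<Rightarrow> 'a) \<Rightarrow> 'a set \<Rightarrow> bool" where
  "subact A act B \<longleftrightarrow> B \<noteq> {} \<and> B \<subseteq> A \<and> (\<forall>b\<in>B. \<forall>s. act b s \<in> B)"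

definition nonzero_subact :: "'a set \<Rightarrow> ('a \<Rightarrow> 's \<Rightarrow> 'a) \<Rightarrow> 'a set \<Rightarrow> bool" where
  "nonzero_subact A act B \<longleftrightarrow> subact A act B \<and> \<not> is_singleton B"

definition act_hom ::
  "'a set \<Rightarrow> ('a \<Rightarrow> 's \<Rightarrow> 'a) \<Rightarrow> 'c set \<Rightarrow> ('c \<Rightarrow> 's \<Rightarrow> 'c) \<Rightarrow> ('a \<Rightarrow> 'c) \<Rightarrow> bool" where
  "act_hom A act C act' g \<longleftrightarrow>
     (\<forall>a\<in>A. g a \<in> C) \<and> (\<forall>a\<in>A. \<forall>s. g (act a s) = act' (g a) s)"

text \<open>A definition cannot quantify over the type of the elements of \<open>C\<close>, so \<open>C\<close> ranges here over
  the acts whose carrier is a set of elements of the type of \<open>A\<close>. Nothing is lost: lemma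
  \<open>large_inj_on\<close> below gives the property for acts \<open>C\<close> over an arbitrary type.\<close>

definition large :: "('s \<Rightarrow> 's \<Rightarrow> 's) \<Rightarrow> 'a set \<Rightarrow> ('a \<Rightarrow> 's \<Rightarrow> 'a) \<Rightarrow> 'a set \<Rightarrow> bool" where
  "large f A act B \<longleftrightarrow> subact A act B \<and>
     (\<forall>(C :: 'a set) act' g.
        right_act f C act' \<longrightarrow> act_hom A act C act' g \<longrightarrow> inj_on g B \<longrightarrow> inj_on g A)"

lemma large_inj_on:
  fixes A B :: "'a set" and C :: "'c set"
  assumes A: "right_act f A act" and "large f A act B"
    and "right_act f C act'" and g: "act_hom A act C act' g" and inj: "inj_on g B"
  shows "inj_on g A"
proof -
  define h where "h = (\<lambda>a. inv_into A g (g a))"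
  define act2 where "act2 = (\<lambda>a s. h (act a s))"
  have B: "subact A act B" using assms(2) by (simp add: large_def)
  have hA: "h a \<in> A" and gh: "g (h a) = g a" if "a \<in> A" for a
    using that by (auto simp: h_def inv_into_into f_inv_into_f)
  have hcong: "h a = h b" if "g a = g b" for a b
    using that by (simp add: h_def)
  have cl: "act a s \<in> A" if "a \<in> A" for a s
    using A that by (simp add: right_act_def)
  have gact: "g (act a s) = act' (g a) s" if "a \<in> A" for a s
    using g that by (simp add: act_hom_def)
  have step: "h (act (h a) s) = h (act a s)" if "a \<in> A" for a s
    using that by (intro hcong) (simp add: gact hA gh)
  have "right_act f (h ` A) act2"
    unfolding right_act_def
  proof (intro conjI ballI allI)
    show "h ` A \<noteq> {}" using A by (simp add: right_act_def)
    show "act2 c s \<in> h ` A" if "c \<in> h ` A" for c s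
      using that by (auto simp: act2_def cl hA)
    show "act2 c (f s t) = act2 (act2 c s) t" if "c \<in> h ` A" for c s t
    proof -
      have c: "c \<in> A" using that hA by auto
      then have "act c (f s t) = act (act c s) t" using A by (simp add: right_act_def)
      then show ?thesis using c by (simp add: act2_def step cl)
    qed
  qed
  moreover have "act_hom A act (h ` A) act2 h"
    by (auto simp: act_hom_def act2_def step)
  moreover have "inj_on h B"
    using inj B gh by (metis inj_onI inj_onD subact_def subsetD)
  ultimately have "inj_on h A"
    using assms(2) unfolding large_def by blast
  then show ?thesis
    using hcong by (meson inj_onD inj_onI)
qed

definition uniform_act :: "('s \<Rightarrow> 's \<Rightarrow> 's) \<Rightarrow> 'a set \<Rightarrow> ('a \<Rightarrow> 's \<Rightarrow> 'a) \<Rightarrow> bool" where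
  "uniform_act f A act \<longleftrightarrow>
     right_act f A act \<and> (\<forall>B. nonzero_subact A act B \<longrightarrow> large f A act B)"

definition uniform_semigroup :: "('s \<Rightarrow> 's \<Rightarrow> 's) \<Rightarrow> bool" where
  "uniform_semigroup f \<longleftrightarrow> uniform_act f UNIV f"

definition left_zero_element :: "('s \<Rightarrow> 's \<Rightarrow> 's) \<Rightarrow> 's \<Rightarrow> bool" where
  "left_zero_element f \<theta> \<longleftrightarrow> (\<forall>s. f \<theta> s = \<theta>)"

definition zero_element :: "('s \<Rightarrow> 's \<Rightarrow> 's) \<Rightarrow> 's \<Rightarrow> bool" where
  "zero_element f z \<longleftrightarrow> (\<forall>s. f z s = z \<and> f s z = z)"

text \<open>The multiplication of \<open>S\<^sup>0\<close>: the underlying set is the type \<open>'s option\<close>, with \<open>None\<close> the new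
  zero and \<open>Some\<close> the embedding of \<open>S\<close>.\<close>

fun adjoin_zero :: "('s \<Rightarrow> 's \<Rightarrow> 's) \<Rightarrow> 's option \<Rightarrow> 's option \<Rightarrow> 's option" where
  "adjoin_zero f (Some s) (Some t) = Some (f s t)"
| "adjoin_zero f None _ = None"
| "adjoin_zero f _ None = None"

lemma right_act_self: "semigroup f \<Longrightarrow> right_act f UNIV f"
  by (simp add: right_act_def semigroup.assoc)

lemma semigroup_adjoin_zero:
  assumes "semigroup f" shows "semigroup (adjoin_zero f)"
proof
  fix a b c
  show "adjoin_zero f (adjoin_zero f a b) c = adjoin_zero f a (adjoin_zero f b c)"
    by (cases a; cases b; cases c) (simp_all add: semigroup.assoc[OF assms])
qed

lemma zero_element_adjoin_zero: "zero_element (adjoin_zero f) None"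
  unfolding zero_element_def by (metis adjoin_zero.simps(2,3) option.exhaust)

end

theory Submission
  imports Defs
begin

text \<open>Largeness only depends on the kernels of homomorphisms, that is, on right congruences: \<open>B\<close> is
  large iff every right congruence that is trivial on \<open>B\<close> is trivial. If \<open>S\<close> has a left zero
  \<open>\<theta>\<close> but no zero, then some \<open>s \<theta> \<noteq> \<theta>\<close> is another left zero; identifying the two is a right
  congruence of \<open>S\<^sup>0\<close> which is trivial on the right ideal \<open>{\<theta>, 0}\<close>, so \<open>S\<^sup>0\<close> is not uniform.
  Conversely, a right congruence of \<open>S\<^sup>0\<close> that is trivial on \<open>S\<close> and relates some \<open>a \<in> S\<close> to \<open>0\<close>
  relates all \<open>a s\<close> to \<open>0\<close>, so all \<open>a s\<close> coincide and \<open>a s\<close> is a left zero.\<close>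

text \<open>The kernel of \<open>h\<close> is then a right congruence on \<open>A\<close>. Encoding
  it by a map with a free value type spares the construction of quotient acts.\<close>

definition act_compatible :: "'a set \<Rightarrow> ('a \<Rightarrow> 's \<Rightarrow> 'a) \<Rightarrow> ('a \<Rightarrow> 'c) \<Rightarrow> bool" where
  "act_compatible A act h \<longleftrightarrow> (\<forall>a\<in>A. \<forall>b\<in>A. h a = h b \<longrightarrow> (\<forall>s. h (act a s) = h (act b s)))"

lemma act_hom_imp_compatible: "act_hom A act C act' g \<Longrightarrow> act_compatible A act g"
  by (simp add: act_hom_def act_compatible_def)

text \<open>Compatibility lets the action descend to the image of \<open>h\<close>, a copy of
  \<open>A\<close> modulo the kernel; \<open>h\<close> becomes a homomorphism onto it, so largeness
  applies.\<close>

lemma large_inj_on_compatible: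
  assumes A: "right_act f A act" and "large f A act B"
    and h: "act_compatible A act h" and "inj_on h B"
  shows "inj_on h A"
proof -
  define act' where "act' c s = h (act (inv_into A h c) s)" for c s
  have cl: "act a s \<in> A" if "a \<in> A" for a s
    using A that by (simp add: right_act_def)
  have act': "act' (h a) s = h (act a s)" if "a \<in> A" for a s
    using h that unfolding act'_def act_compatible_def
    by (metis f_inv_into_f imageI inv_into_into)
  have "right_act f (h ` A) act'"
    using A by (auto simp: right_act_def act' cl)
  moreover have "act_hom A act (h ` A) act' h"
    by (simp add: act_hom_def act')
  ultimately show ?thesis
    using large_inj_on[OF A assms(2)] assms(4) by blast
qed

lemma uniform_actD:
  assumes "uniform_act f A act" "nonzero_subact A act B"
    and "act_compatible A act h" "inj_on h B"
  shows "inj_on h A"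
  using assms large_inj_on_compatible unfolding uniform_act_def by blast

text \<open>Maps \<open>h\<close> from \<open>'a\<close> to \<open>'a\<close> suffice, since
  \<open>large\<close> tests only acts within the type of \<open>A\<close> and every homomorphism is
  compatible.\<close>

lemma uniform_actI:
  fixes A :: "'a set"
  assumes "right_act f A act"
    and "\<And>B (h :: 'a \<Rightarrow> 'a).
      nonzero_subact A act B \<Longrightarrow> act_compatible A act h \<Longrightarrow> inj_on h B \<Longrightarrow> inj_on h A"
  shows "uniform_act f A act"
  using assms act_hom_imp_compatible unfolding uniform_act_def large_def nonzero_subact_def by metis

lemma adjoin_zero_None_right [simp]: "adjoin_zero f a None = None"
  by (cases a) simp_all

lemma left_zero_element_mult:
  assumes "semigroup f" "left_zero_element f \<theta>"
  shows "left_zero_element f (f s \<theta>)"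
  using assms by (simp add: left_zero_element_def semigroup.assoc)

lemma uniform_adjoin_zero_imp_no_left_zero:
  assumes S: "semigroup f" and nz: "\<nexists>z. zero_element f z"
    and unif: "uniform_semigroup (adjoin_zero f)"
  shows "\<not> left_zero_element f \<theta>"
proof
  assume \<theta>: "left_zero_element f \<theta>"
  then obtain s where s: "f s \<theta> \<noteq> \<theta>"
    using nz unfolding zero_element_def left_zero_element_def by blast
  define \<eta> where "\<eta> = f s \<theta>"
  have \<eta>: "left_zero_element f \<eta>" "\<eta> \<noteq> \<theta>"
    using left_zero_element_mult[OF S \<theta>] s by (simp_all add: \<eta>_def)
  define h where "h x = (if x = Some \<eta> then Some \<theta> else x)" for x
  have stable: "adjoin_zero f (Some \<zeta>) x \<in> {Some \<zeta>, None}" if "left_zero_element f \<zeta>" for \<zeta> x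
    using that by (cases x) (simp_all add: left_zero_element_def)
  \<comment> \<open>The left zero alone forms a one-element subact; together with the adjoined zero
    it forms a nonzero one.\<close>
  have "nonzero_subact UNIV (adjoin_zero f) {Some \<theta>, None}"
    using stable[OF \<theta>] by (auto simp: nonzero_subact_def subact_def is_singleton_def)
  moreover have "act_compatible UNIV (adjoin_zero f) h"
  proof -
    \<comment> \<open>For \<open>x\<close> in \<open>S\<close> the products are the two left zeros
      themselves, which \<open>h\<close> identifies; for \<open>x = None\<close> both are
      \<open>None\<close>.\<close>
    have "h (adjoin_zero f (Some \<eta>) x) = h (adjoin_zero f (Some \<theta>) x)" for x
      using \<theta> \<eta> by (cases x) (simp_all add: h_def left_zero_element_def)
    then show ?thesis
      unfolding act_compatible_def h_def by metis
  qed
  moreover have "inj_on h {Some \<theta>, None}"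
    using \<eta>(2) by (simp add: h_def)
  ultimately have "inj h"
    using unif uniform_actD unfolding uniform_semigroup_def by blast
  moreover have "h (Some \<eta>) = h (Some \<theta>)"
    by (simp add: h_def)
  ultimately show False
    using \<eta>(2) by (simp add: inj_eq)
qed

text \<open>A right ideal of \<open>S\<close> extends by adding \<open>0\<close>, and a right
  congruence by making \<open>0\<close> a class of its own; triviality on the larger act then
  restricts to \<open>S\<close>.\<close>

lemma uniform_adjoin_zero_imp_uniform:
  assumes S: "semigroup f" and unif: "uniform_semigroup (adjoin_zero f)"
  shows "uniform_semigroup f"
  unfolding uniform_semigroup_def
proof (rule uniform_actI)
  show "right_act f UNIV f"
    by (rule right_act_self[OF S])
  fix B and h :: "'a \<Rightarrow> 'a"
  assume B: "nonzero_subact UNIV f B" and h: "act_compatible UNIV f h" and inj: "inj_on h B"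
  let ?B = "insert None (Some ` B)"
  have "adjoin_zero f b x \<in> ?B" if "b \<in> ?B" for b x
    using B that by (cases x) (auto simp: nonzero_subact_def subact_def)
  moreover have "\<not> is_singleton ?B"
    using B by (auto simp: nonzero_subact_def subact_def is_singleton_def)
  ultimately have "nonzero_subact UNIV (adjoin_zero f) ?B"
    by (simp add: nonzero_subact_def subact_def)
  moreover have "act_compatible UNIV (adjoin_zero f) (map_option h)"
    unfolding act_compatible_def
  proof (intro ballI impI allI)
    fix a b x :: "'a option"
    assume eq: "map_option h a = map_option h b"
    have step: "h (f s u) = h (f t u)" if "h s = h t" for s t u
      using h that unfolding act_compatible_def by blast
    show "map_option h (adjoin_zero f a x) = map_option h (adjoin_zero f b x)"
      using eq by (cases a; cases b; cases x) (simp_all, rule step)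
  qed
  moreover have "inj_on (map_option h) ?B"
    using inj by (auto simp: inj_on_def)
  ultimately have "inj (map_option h)"
    using unif uniform_actD unfolding uniform_semigroup_def by blast
  \<comment> \<open>This composite equals \<open>Some \<circ> h\<close>.\<close>
  then have "inj (map_option h \<circ> Some)"
    by (intro inj_compose) simp_all
  then show "inj h"
    by (simp add: inj_def)
qed

lemma uniform_adjoin_zero:
  assumes S: "semigroup f" and unif: "uniform_semigroup f"
    and no_left_zero: "\<nexists>\<theta>. left_zero_element f \<theta>"
  shows "uniform_semigroup (adjoin_zero f)"
  unfolding uniform_semigroup_def
proof (rule uniform_actI)
  show "right_act (adjoin_zero f) UNIV (adjoin_zero f)"
    by (rule right_act_self[OF semigroup_adjoin_zero[OF S]])
  fix B and h :: "'a option \<Rightarrow> 'a option"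
  assume B: "nonzero_subact UNIV (adjoin_zero f) B"
    and h: "act_compatible UNIV (adjoin_zero f) h" and inj: "inj_on h B"
  let ?B = "Some -` B"
  have closed: "adjoin_zero f b x \<in> B" if "b \<in> B" for b x
    using B that by (simp add: nonzero_subact_def subact_def)
  have closed': "f b s \<in> ?B" if "b \<in> ?B" for b s
    using closed[of "Some b" "Some s"] that by simp
  have "?B \<noteq> {}"
  proof
    assume "?B = {}"
    then have "B \<subseteq> {None}"
      by (auto simp: vimage_def) (metis not_None_eq)
    with B show False
      by (auto simp: nonzero_subact_def subact_def is_singleton_def)
  qed
  \<comment> \<open>The element of a one-element right ideal is a left zero.\<close>
  moreover have "\<not> is_singleton ?B"
    using closed' no_left_zero unfolding is_singleton_def left_zero_element_def
    by (metis singletonD singletonI)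
  ultimately have "nonzero_subact UNIV f ?B"
    using closed' by (simp add: nonzero_subact_def subact_def)
  moreover have "act_compatible UNIV f (h \<circ> Some)"
    using h unfolding act_compatible_def o_def by (metis UNIV_I adjoin_zero.simps(1))
  moreover have "inj_on (h \<circ> Some) ?B"
    using inj by (auto simp: inj_on_def)
  ultimately have inj_Some: "inj (h \<circ> Some)"
    using unif uniform_actD unfolding uniform_semigroup_def by blast
  \<comment> \<open>Since \<open>h\<close> is injective on \<open>S\<close>, only a collision with
    \<open>0\<close> remains to be excluded.\<close>
  have "h (Some a) \<noteq> h None" for a
  proof
    assume "h (Some a) = h None"
    then have "h (adjoin_zero f (Some a) x) = h (adjoin_zero f None x)" for x
      using h unfolding act_compatible_def by blast
    then have "h (Some (f a s)) = h None" for s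
      by (metis adjoin_zero.simps(1,2))
    then have const: "f a s = f a t" for s t
      using inj_Some by (metis comp_apply injD)
    \<comment> \<open>By associativity \<open>(a a) s = a (a s)\<close>, and this is
      \<open>a a\<close> because all right multiples of \<open>a\<close> agree.\<close>
    have "left_zero_element f (f a a)"
      unfolding left_zero_element_def by (metis S semigroup.assoc const)
    with no_left_zero show False by blast
  qed
  then show "inj h"
    using inj_Some by (simp add: inj_def split_option_all) metis
qed

theorem theorem2p8:
  fixes f :: "'s \<Rightarrow> 's \<Rightarrow> 's"
  assumes "semigroup f"
    and "\<exists>x y :: 's. x \<noteq> y"
    and "\<not> (\<exists>z. zero_element f z)"
  shows "uniform_semigroup (adjoin_zero f) \<longleftrightarrow>
           uniform_semigroup f \<and> \<not> (\<exists>\<theta>. left_zero_element f \<theta>)"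
  using uniform_adjoin_zero[OF assms(1)] uniform_adjoin_zero_imp_uniform[OF assms(1)]
    uniform_adjoin_zero_imp_no_left_zero[OF assms(1,3)] by auto

end
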